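(* For every integer $k\ge 8$ that is a power of two and every sufficiently large $n$, we have $g\left(n,k,\frac{k^{\log_2 3}+1}{2}\right)=\Omega\left(n^{1+\frac{2}{k-2}}\right)$, where the implied constant may depend on $k$.
   Context: For a finite set $A\subset\mathbb{R}$, define its (positive) difference set $A-A=\{a-a' : a,a'\in A,\ a-a'>0\}$. For positive integers $n,k$ and a real $\ell$, let $g(n,k,\ell)$ be the minimum of $|A-A|$ over all sets $A$ of $n$ real numbers such that every subset $A'\subset A$ with $|A'|=k$ satisfies $|A'-A'|\ge \ell$. *)

theory Defs
  imports Complex_Main "HOL-Library.Landau_Symbols"
begin

definition pos_diff_set :: "real set \<Rightarrow> real set" where
  "pos_diff_set A = {a - a' | a a'. a \<in> A \<and> a' \<in> A \<and> a - a' > 0}"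

definition locally_diverse :: "nat \<Rightarrow> nat \<Rightarrow> real \<Rightarrow> real set \<Rightarrow> bool" where
  "locally_diverse n k l A \<longleftrightarrow>
     finite A \<and> card A = n \<and>
     (\<forall>A'. A' \<subseteq> A \<and> card A' = k \<longrightarrow> real (card (pos_diff_set A')) \<ge> l)"

text \<open>
  The infimum of a nonempty set of naturals is attained, so this is a genuine minimum whenever
  some admissible set exists; this is the case for all \<open>n\<close> if \<open>l \<le> k (k - 1) / 2\<close>
  (take a set all of whose positive differences are distinct). It carries no meaning if there
  is no admissible set.
\<close>
definition g :: "nat \<Rightarrow> nat \<Rightarrow> real \<Rightarrow> nat" where
  "g n k l = Inf {card (pos_diff_set A) | A. locally_diverse n k l A}"

end

theory Submission
  imports Defs
begin

text \<open>
  Let \<open>k = 2 ^ m\<close>. A Hilbert cube \<open>b + {0, d\<^sub>1} + \<dots> + {0, d\<^sub>m}\<close> with \<open>k\<close> distinct elements has at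
  most \<open>3 ^ m\<close> differences, hence at most \<open>(3 ^ m - 1) / 2\<close> positive ones, so an admissible set
  \<open>A\<close> contains no such cube. If \<open>D = |A - A|\<close>, then pigeonhole on the pairs of \<open>B \<subseteq> A\<close> yields a
  difference \<open>d\<close>, outside any prescribed bounded set, with \<open>|B \<inter> (B - d)| \<ge> |B|\<^sup>2 / (4 D)\<close>.
  Iterating \<open>m - 1\<close> times keeps at least \<open>n ^ (k / 2) / (4 D) ^ (k / 2 - 1)\<close> base points; were
  this larger than a suitable constant, one more step would produce a cube of dimension \<open>m\<close>.
\<close>

section \<open>Signed and positive difference sets\<close>

text \<open>Signed differences, including 0, at most triple in number when a cube is doubled. A
  count p of positive differences would only satisfy the less convenient bound 3p + 1.\<close>

definition diff_set :: "real set \<Rightarrow> real set" where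
  "diff_set S = (\<lambda>(x, y). x - y) ` (S \<times> S)"

lemma finite_diff_set: "finite S \<Longrightarrow> finite (diff_set S)"
  by (simp add: diff_set_def)

lemma pos_diff_set_eq_image: "pos_diff_set A = (\<lambda>(x, y). x - y) ` {(x, y) \<in> A \<times> A. y < x}"
  by (auto simp: pos_diff_set_def image_iff)

lemma finite_pos_diff_set:
  assumes "finite A"
  shows "finite (pos_diff_set A)"
proof -
  have "finite {(x, y) \<in> A \<times> A. y < x}"
    by (rule finite_subset[of _ "A \<times> A"]) (use assms in auto)
  then show ?thesis
    by (simp add: pos_diff_set_eq_image)
qed

lemma card_diff_set:
  assumes "finite S" "S \<noteq> {}"
  shows "card (diff_set S) = 2 * card (pos_diff_set S) + 1"
proof -
  let ?P = "pos_diff_set S"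
  have P: "p > 0" if "p \<in> ?P" for p
    using that by (auto simp: pos_diff_set_def)
  have fin: "finite ?P"
    using assms by (simp add: finite_pos_diff_set)
  have "diff_set S = insert 0 (?P \<union> uminus ` ?P)"
  proof (intro equalityI subsetI)
    fix x assume "x \<in> diff_set S"
    then obtain a b where ab: "a \<in> S" "b \<in> S" "x = a - b"
      by (auto simp: diff_set_def)
    consider "a = b" | "a > b" | "b > a" by linarith
    then show "x \<in> insert 0 (?P \<union> uminus ` ?P)"
    proof cases
      case 2
      then show ?thesis using ab by (auto simp: pos_diff_set_def)
    next
      case 3
      then have "b - a \<in> ?P" using ab by (auto simp: pos_diff_set_def)
      moreover have "x = - (b - a)" using ab by simp
      ultimately show ?thesis by blast
    qed (use ab in simp)
  next
    fix x assume "x \<in> insert 0 (?P \<union> uminus ` ?P)"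
    with assms(2) show "x \<in> diff_set S"
      by (force simp: diff_set_def pos_diff_set_def image_iff)
  qed
  moreover have "?P \<inter> uminus ` ?P = {}"
    by (auto dest!: P)
  moreover have "0 \<notin> ?P \<union> uminus ` ?P"
    by (auto dest!: P)
  ultimately show ?thesis
    using fin by (simp add: card_Un_disjoint card_image)
qed

lemma pos_diff_set_translate: "pos_diff_set ((+) c ` S) = pos_diff_set S"
  unfolding pos_diff_set_eq_image by (force simp: image_iff)

section \<open>Popular differences\<close>

lemma card_ordered_pairs:
  fixes A :: "'a::linorder set"
  assumes "finite A"
  shows "2 * card {(x, y) \<in> A \<times> A. y < x} + card A = (card A)\<^sup>2"
proof -
  let ?L = "{(x, y) \<in> A \<times> A. y < x}" and ?R = "{(x, y) \<in> A \<times> A. x < y}"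
  have fin: "finite ?L" "finite ?R"
    by (rule finite_subset[of _ "A \<times> A"]; use assms in auto)+
  have "bij_betw prod.swap ?L ?R"
    by (rule bij_betw_byWitness[where f' = prod.swap]) auto
  then have "card ?L = card ?R"
    by (rule bij_betw_same_card)
  moreover have "card (Id_on A) = card A"
  proof -
    have "Id_on A = (\<lambda>x. (x, x)) ` A" by auto
    then show ?thesis by (simp add: card_image inj_on_def)
  qed
  moreover have "card (A \<times> A) = card (?L \<union> ?R \<union> Id_on A)"
    by (rule arg_cong[where f = card]) (auto simp: Id_on_iff)
  moreover have "card (?L \<union> ?R \<union> Id_on A) = card ?L + card ?R + card (Id_on A)"
  proof -
    have "finite (Id_on A)"
      by (rule finite_subset[of _ "A \<times> A"]) (use assms in auto)
    moreover have "(?L \<union> ?R) \<inter> Id_on A = {}" "?L \<inter> ?R = {}" by auto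
    ultimately show ?thesis using fin by (simp only: card_Un_disjoint finite_Un)
  qed
  ultimately show ?thesis
    by (simp add: card_cartesian_product power2_eq_square)
qed

text \<open>The pairs \<open>y < x\<close> in \<open>B\<close> split into fibres by their
  difference. Each fibre has at most \<open>card B\<close> pairs, so \<open>F\<close> absorbs few of
  them, and averaging the rest over at most \<open>card D\<close> differences gives
  \<open>d\<close>. Avoiding \<open>F\<close> is what later keeps the cubes nondegenerate.\<close>

lemma popular_difference:
  fixes B D F :: "real set"
  assumes B: "finite B" "4 * card F + 2 \<le> card B" and F: "finite F"
    and D: "finite D" "pos_diff_set B \<subseteq> D"
  obtains d where "d > 0" "d \<notin> F" "(card B)\<^sup>2 \<le> 4 * card D * card {y \<in> B. y + d \<in> B}"
proof -
  let ?b = "card B" and ?E = "pos_diff_set B"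
  let ?fib = "\<lambda>d. {y \<in> B. y + d \<in> B}"
  have finE: "finite ?E"
    using B by (simp add: finite_pos_diff_set)
  have "{(x, y) \<in> B \<times> B. y < x} \<subseteq> (\<Union>d\<in>?E. (\<lambda>y. (y + d, y)) ` ?fib d)"
  proof clarify
    fix x y assume "x \<in> B" "y \<in> B" "y < x"
    then have "x - y \<in> ?E" "(x, y) \<in> (\<lambda>z. (z + (x - y), z)) ` ?fib (x - y)"
      by (auto simp: pos_diff_set_def image_iff)
    then show "(x, y) \<in> (\<Union>d\<in>?E. (\<lambda>y. (y + d, y)) ` ?fib d)" by blast
  qed
  then have "card {(x, y) \<in> B \<times> B. y < x} \<le> card (\<Union>d\<in>?E. (\<lambda>y. (y + d, y)) ` ?fib d)"
    using B finE by (intro card_mono) auto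
  also have "\<dots> \<le> (\<Sum>d\<in>?E. card ((\<lambda>y. (y + d, y)) ` ?fib d))"
    by (rule card_UN_le[OF finE])
  also have "\<dots> \<le> (\<Sum>d\<in>?E. card (?fib d))"
    using B by (intro sum_mono card_image_le) simp
  also have "\<dots> = (\<Sum>d\<in>?E \<inter> F. card (?fib d)) + (\<Sum>d\<in>?E - F. card (?fib d))"
    by (rule sum.Int_Diff[OF finE])
  also have "(\<Sum>d\<in>?E \<inter> F. card (?fib d)) \<le> card (?E \<inter> F) * ?b"
    using B by (intro order.trans[OF sum_bounded_above[where K = ?b]]) (auto intro: card_mono)
  also have "\<dots> \<le> card F * ?b"
    using F by (intro mult_right_mono card_mono) auto
  finally have pairs: "card {(x, y) \<in> B \<times> B. y < x} \<le> card F * ?b + (\<Sum>d\<in>?E - F. card (?fib d))"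
    by simp
  \<comment> \<open>With b = \<open>?b\<close>, this says that |F| b is at most b^2/4 - b/2, so of
    the (b^2 - b)/2 pairs at least b^2/4 have their difference outside \<open>F\<close>.\<close>
  have "(4 * card F + 2) * ?b \<le> ?b\<^sup>2"
    using B(2) unfolding power2_eq_square by (rule mult_right_mono) simp
  then have large: "?b\<^sup>2 \<le> 4 * (\<Sum>d\<in>?E - F. card (?fib d))"
    using pairs card_ordered_pairs[OF B(1)] by (simp add: algebra_simps)
  have "\<exists>d\<in>?E - F. ?b\<^sup>2 \<le> 4 * card D * card (?fib d)"
  proof (rule ccontr)
    assume "\<not> ?thesis"
    then have small: "4 * card D * card (?fib d) < ?b\<^sup>2" if "d \<in> ?E - F" for d
      using that by (meson not_le)
    have "?E - F \<noteq> {}"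
      using large B by (intro notI) simp
    then have "(\<Sum>d\<in>?E - F. 4 * card D * card (?fib d)) < (\<Sum>d\<in>?E - F. ?b\<^sup>2)"
      using finE small by (intro sum_strict_mono) auto
    also have "\<dots> \<le> card D * ?b\<^sup>2"
      using D by (auto intro!: mult_right_mono card_mono)
    also have "\<dots> \<le> card D * (4 * (\<Sum>d\<in>?E - F. card (?fib d)))"
      using large by (rule mult_left_mono) simp
    finally show False
      by (simp add: sum_distrib_left mult_ac)
  qed
  then obtain d where "d \<in> ?E - F" "?b\<^sup>2 \<le> 4 * card D * card (?fib d)" by blast
  then show ?thesis
    using that[of d] by (auto simp: pos_diff_set_def)
qed

section \<open>Building Hilbert cubes\<close>

text \<open>A common point of \<open>S\<close> and its translate would make \<open>d\<close> a
  difference of \<open>S\<close>. Differences within or across the two copies lie in T, T + d or T -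
  d, where T = \<open>diff_set S\<close>.\<close>

lemma double_diff_set:
  assumes "finite S" "d \<notin> diff_set S"
  shows "card (S \<union> (+) d ` S) = 2 * card S"
    and "card (diff_set (S \<union> (+) d ` S)) \<le> 3 * card (diff_set S)"
proof -
  have "S \<inter> (+) d ` S = {}"
    using assms(2) by (force simp: diff_set_def image_iff)
  then show "card (S \<union> (+) d ` S) = 2 * card S"
    using assms(1) by (simp add: card_Un_disjoint card_image)
  let ?T = "diff_set S"
  have in_T: "x - y \<in> ?T" if "x \<in> S" "y \<in> S" for x y
    using that by (auto simp: diff_set_def)
  have "diff_set (S \<union> (+) d ` S) \<subseteq> ?T \<union> ((+) d ` ?T \<union> (+) (- d) ` ?T)"
  proof
    fix z assume "z \<in> diff_set (S \<union> (+) d ` S)"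
    then obtain x y where "x \<in> S" "y \<in> S"
      "z = x - y \<or> z = d + (x - y) \<or> z = - d + (x - y)"
      by (auto simp: diff_set_def algebra_simps)
    then show "z \<in> ?T \<union> ((+) d ` ?T \<union> (+) (- d) ` ?T)"
      using in_T by blast
  qed
  then have "card (diff_set (S \<union> (+) d ` S)) \<le> card (?T \<union> ((+) d ` ?T \<union> (+) (- d) ` ?T))"
    using assms(1) by (intro card_mono) (auto simp: finite_diff_set)
  also have "\<dots> \<le> card ?T + (card ((+) d ` ?T) + card ((+) (- d) ` ?T))"
    by (meson card_Un_le order.trans add_left_mono)
  also have "\<dots> = 3 * card ?T"
    by (simp add: card_image)
  finally show "card (diff_set (S \<union> (+) d ` S)) \<le> 3 * card (diff_set S)" .
qed

text \<open>The cube is doubled \<open>Suc m\<close> times along popular differences.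
  \<open>few\<close> keeps at least \<open>Q\<close> base points before each doubling, and
  \<open>Q\<close> exceeds four times the at most 3^m differences to be avoided, as
  \<open>popular_difference\<close> requires.\<close>

lemma nondegenerate_hilbert_cube:
  fixes A :: "real set" and m Q :: nat
  defines "D \<equiv> card (pos_diff_set A)"
  assumes A: "finite A" "Q \<le> card A"
    and Q: "4 * 3 ^ m + 2 \<le> Q"
    and few: "Q * (4 * D) ^ (2 ^ m - 1) \<le> card A ^ 2 ^ m"
  obtains S b where "finite S" "card S = 2 ^ Suc m" "card (diff_set S) \<le> 3 ^ Suc m" "(+) b ` S \<subseteq> A"
proof -
  let ?n = "card A"
  have finP: "finite (pos_diff_set A)"
    using A by (simp add: finite_pos_diff_set)
  \<comment> \<open>A popular difference with nothing to avoid gives n^2 \<le> 4 D n. This later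
    allows factors n to be traded for 4 D.\<close>
  have n4D: "?n \<le> 4 * D"
  proof -
    obtain d where d: "?n\<^sup>2 \<le> 4 * D * card {y \<in> A. y + d \<in> A}"
      using popular_difference[of A "{}" "pos_diff_set A"] A Q finP unfolding D_def by auto
    have "card {y \<in> A. y + d \<in> A} \<le> ?n"
      using A by (intro card_mono) auto
    then have "?n * ?n \<le> 4 * D * ?n"
      using d order.trans[OF _ mult_le_mono2] unfolding power2_eq_square by blast
    then show ?thesis using A Q by simp
  qed
  have npos: "?n > 0" using A Q by simp
  then have Dpos: "4 * D > 0" using n4D by linarith
  \<comment> \<open>\<open>S\<close> is a cube of dimension \<open>i\<close> and \<open>B\<close> a
    set of admissible base points. The last conjunct is the iterated bound |B'| \<ge> |B|^2 / (4 D),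
    stated without division.\<close>
  have "\<exists>S B. finite S \<and> card S = 2 ^ i \<and> card (diff_set S) \<le> 3 ^ i \<and> B \<subseteq> A \<and>
      (\<forall>b\<in>B. (+) b ` S \<subseteq> A) \<and> ?n ^ 2 ^ i \<le> card B * (4 * D) ^ (2 ^ i - 1)"
    if "i \<le> Suc m" for i
    using that
  proof (induction i)
    case 0
    show ?case
      by (rule exI[of _ "{0}"], rule exI[of _ A]) (auto simp: diff_set_def)
  next
    case (Suc i)
    then obtain S B where S: "finite S" "card S = 2 ^ i" "card (diff_set S) \<le> 3 ^ i"
      and BA: "B \<subseteq> A" and cube: "\<forall>b\<in>B. (+) b ` S \<subseteq> A"
      and B: "?n ^ 2 ^ i \<le> card B * (4 * D) ^ (2 ^ i - 1)"
      by (meson Suc_leD)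
    have finB: "finite B" using BA A finite_subset by blast
    have im: "(2::nat) ^ i \<le> 2 ^ m" using Suc.prems by simp
    have one: "(1::nat) \<le> 2 ^ i" by simp
    \<comment> \<open>To see that \<open>B\<close> still has \<open>Q\<close> points, the invariant
      is raised from exponent 2^i to 2^m, where \<open>few\<close> applies, and the power of 4 D is
      cancelled.\<close>
    have "Q * (4 * D) ^ (2 ^ i - 1) * (4 * D) ^ (2 ^ m - 2 ^ i) = Q * (4 * D) ^ (2 ^ m - 1)"
    proof -
      have "2 ^ m - 1 = (2 ^ i - 1) + (2 ^ m - 2 ^ i :: nat)" using im one by linarith
      then show ?thesis by (simp only: power_add mult.assoc)
    qed
    also have "\<dots> \<le> ?n ^ 2 ^ i * ?n ^ (2 ^ m - 2 ^ i)"
      using few im by (simp flip: power_add)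
    also have "\<dots> \<le> card B * (4 * D) ^ (2 ^ i - 1) * (4 * D) ^ (2 ^ m - 2 ^ i)"
      using n4D by (intro mult_mono B power_mono) auto
    finally have "Q \<le> card B"
      using Dpos by simp
    moreover have "(3::nat) ^ i \<le> 3 ^ m"
      using Suc.prems by (intro power_increasing) auto
    ultimately have "4 * card (diff_set S) + 2 \<le> card B"
      using S(3) Q by linarith
    moreover have "pos_diff_set B \<subseteq> pos_diff_set A"
      using BA by (auto simp: pos_diff_set_def)
    ultimately obtain d where d: "d \<notin> diff_set S"
      and many: "(card B)\<^sup>2 \<le> 4 * D * card {y \<in> B. y + d \<in> B}"
      using popular_difference[of B "diff_set S" "pos_diff_set A"] finB finP S(1)
      unfolding D_def by (auto simp: finite_diff_set)
    \<comment> \<open>A base point y survives if y + d is one too: then both halves y + S and y + d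
      + S lie in \<open>A\<close>.\<close>
    let ?S = "S \<union> (+) d ` S" and ?B = "{y \<in> B. y + d \<in> B}"
    have "(+) b ` ?S \<subseteq> A" if "b \<in> ?B" for b
    proof -
      have "(+) b ` ?S = (+) b ` S \<union> (+) (b + d) ` S"
        by (simp add: image_Un image_image add.assoc)
      then show ?thesis using that cube by auto
    qed
    moreover have "?n ^ 2 ^ Suc i \<le> card ?B * (4 * D) ^ (2 ^ Suc i - 1)"
    proof -
      have "?n ^ 2 ^ Suc i = (?n ^ 2 ^ i)\<^sup>2"
        by (metis power_Suc mult.commute power_mult)
      also have "\<dots> \<le> (card B * (4 * D) ^ (2 ^ i - 1))\<^sup>2"
        using B by (rule power_mono) simp
      also have "\<dots> = (card B)\<^sup>2 * (4 * D) ^ (2 * (2 ^ i - 1))"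
        by (metis power_mult_distrib power_mult mult.commute)
      also have "\<dots> \<le> (4 * D * card ?B) * (4 * D) ^ (2 * (2 ^ i - 1))"
        using many by (rule mult_right_mono) simp
      also have "\<dots> = card ?B * (4 * D) ^ Suc (2 * (2 ^ i - 1))"
        by (simp only: power_Suc mult_ac)
      also have "Suc (2 * (2 ^ i - 1)) = 2 ^ Suc i - 1"
        using one unfolding power_Suc by linarith
      finally show ?thesis .
    qed
    moreover have "finite ?S" "card ?S = 2 ^ Suc i" "card (diff_set ?S) \<le> 3 ^ Suc i" "?B \<subseteq> A"
      using S double_diff_set[OF S(1) d] BA by auto
    ultimately show ?case by blast
  qed
  from this[of "Suc m"] obtain S B where
    S: "finite S" "card S = 2 ^ Suc m" "card (diff_set S) \<le> 3 ^ Suc m" "\<forall>b\<in>B. (+) b ` S \<subseteq> A"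
    and B: "?n ^ 2 ^ Suc m \<le> card B * (4 * D) ^ (2 ^ Suc m - 1)"
    by auto
  \<comment> \<open>After the last doubling a single base point suffices, and the invariant with n >
    0 provides one.\<close>
  have "card B \<noteq> 0"
    using B npos by (intro notI) simp
  then obtain b where "b \<in> B" by fastforce
  then show ?thesis using that S by blast
qed

text \<open>Otherwise \<open>A\<close> contains a translated cube of dimension \<open>Suc m\<close>.
  It has at most (3^(m+1) - 1)/2 positive differences, hence falls short of the required number by
  at least one.\<close>

lemma locally_diverse_card_bound:
  assumes A: "locally_diverse n (2 ^ Suc m) ((3 ^ Suc m + 1) / 2) A"
    and n: "4 * 3 ^ m + 2 \<le> n"
  shows "n ^ 2 ^ m < (4 * 3 ^ m + 2) * (4 * card (pos_diff_set A)) ^ (2 ^ m - 1)"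
proof (rule ccontr)
  assume "\<not> ?thesis"
  then obtain S b where S: "finite S" "card S = 2 ^ Suc m" "card (diff_set S) \<le> 3 ^ Suc m"
    "(+) b ` S \<subseteq> A"
    using nondegenerate_hilbert_cube[of A "4 * 3 ^ m + 2" m] A n
    by (auto simp: locally_diverse_def not_less)
  have "card ((+) b ` S) = 2 ^ Suc m"
    using S by (simp add: card_image)
  then have "(3 ^ Suc m + 1) / 2 \<le> real (card (pos_diff_set S))"
    using A S(4) unfolding locally_diverse_def by (metis pos_diff_set_translate)
  moreover have "S \<noteq> {}" using S by auto
  then have "2 * card (pos_diff_set S) + 1 \<le> 3 ^ Suc m"
    using S card_diff_set by metis
  then have "real (2 * card (pos_diff_set S) + 1) \<le> real (3 ^ Suc m)"
    by (rule of_nat_mono)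
  ultimately show False by simp
qed

section \<open>Existence of admissible sets\<close>

lemma inj_on_diff_powers_of_three:
  fixes A :: "real set"
  assumes "A \<subseteq> range (\<lambda>i::nat. 3 ^ i)"
  shows "inj_on (\<lambda>(x, y). x - y) {(x, y) \<in> A \<times> A. y < x}"
proof -
  \<comment> \<open>The larger exponent dominates: 3^i - 3^j is at least 2 * 3^(i-1), while the
    other difference is below 3^(i-1). So a difference determines its larger power, and then its
    smaller one.\<close>
  have lt: "(3::real) ^ i' - 3 ^ j' < 3 ^ i - 3 ^ j" if "i' < i" "j < i" for i i' j j' :: nat
  proof -
    obtain l where l: "i = Suc l" using \<open>j < i\<close> by (cases i) auto
    have "(3::real) ^ i' \<le> 3 ^ l" "(3::real) ^ j \<le> 3 ^ l" "(0::real) < 3 ^ j'" "(0::real) < 3 ^ l"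
      using that l by (auto intro: power_increasing)
    then show ?thesis unfolding l power_Suc by linarith
  qed
  show ?thesis
  proof (rule inj_onI, clarify)
    fix x y x' y' :: real
    assume xy: "x \<in> A" "y \<in> A" "x' \<in> A" "y' \<in> A" and "y < x" "y' < x'" and eq: "x - y = x' - y'"
    have "\<exists>i::nat. z = 3 ^ i" if "z \<in> A" for z
      using that assms by blast
    then obtain i j i' j' :: nat where
      ij: "x = 3 ^ i" "y = 3 ^ j" "x' = 3 ^ i'" "y' = 3 ^ j'"
      using xy by meson
    then have "j < i" "j' < i'"
      using \<open>y < x\<close> \<open>y' < x'\<close> by simp_all
    then have "i = i'"
      using lt[of i' i j j'] lt[of i i' j' j] eq ij by (cases i i' rule: linorder_cases) auto
    then show "x = x' \<and> y = y'"
      using eq ij by simp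
  qed
qed

text \<open>Powers of three have distinct positive differences, so each k-subset attains the maximal
  number k(k - 1)/2.\<close>

lemma locally_diverse_exists:
  assumes "l \<le> real k * (real k - 1) / 2" and "k > 0"
  shows "\<exists>A. locally_diverse n k l A"
proof -
  let ?A = "(\<lambda>i::nat. 3 ^ i :: real) ` {..<n}"
  have "l \<le> real (card (pos_diff_set A'))" if "A' \<subseteq> ?A" "card A' = k" for A'
  proof -
    have "A' \<subseteq> range (\<lambda>i::nat. 3 ^ i)" using that by blast
    then have "card (pos_diff_set A') = card {(x, y) \<in> A' \<times> A'. y < x}"
      unfolding pos_diff_set_eq_image by (intro card_image inj_on_diff_powers_of_three)
    moreover have "finite A'" using that assms card_ge_0_finite by blast
    ultimately have "2 * card (pos_diff_set A') + k = k\<^sup>2"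
      using card_ordered_pairs[of A'] that by simp
    then have "2 * real (card (pos_diff_set A')) + real k = real k * real k"
      by (metis of_nat_add of_nat_mult of_nat_numeral power2_eq_square)
    then show ?thesis using assms by (simp add: algebra_simps)
  qed
  moreover have "card ?A = n"
    by (simp add: card_image inj_on_def)
  ultimately have "locally_diverse n k l ?A"
    by (auto simp: locally_diverse_def)
  then show ?thesis ..
qed

lemma g_attained:
  assumes "\<exists>A. locally_diverse n k l A"
  obtains A where "locally_diverse n k l A" "g n k l = card (pos_diff_set A)"
proof -
  have "Inf {card (pos_diff_set A) | A. locally_diverse n k l A}
      \<in> {card (pos_diff_set A) | A. locally_diverse n k l A}"
    by (rule Inf_nat_def1) (use assms in auto)
  then show ?thesis using that by (auto simp: g_def)
qed

section \<open>Real exponents and the asymptotic bound\<close>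

text \<open>Raise the hypothesis to the power 1/(M - 1), using M/(M - 1) = 1 + 1/(M - 1).\<close>

lemma powr_le_of_power_less:
  fixes x y q :: real and M :: nat
  assumes "x ^ M < q * y ^ (M - 1)" "0 < x" "0 \<le> y" "0 < q" "2 \<le> M"
  shows "x powr (1 + 1 / (real M - 1)) \<le> q powr (1 / (real M - 1)) * y"
proof -
  let ?e = "1 / (real M - 1)"
  have "y \<noteq> 0"
    using assms by (intro notI) (auto simp: zero_power)
  then have y: "y > 0" using assms by simp
  have M: "real M * ?e = 1 + ?e" "real (M - 1) * ?e = 1"
    using assms by (auto simp: field_simps of_nat_diff)
  have "x powr (1 + ?e) = (x ^ M) powr ?e"
    using assms M by (simp only: powr_powr flip: powr_realpow)
  also have "\<dots> \<le> (q * y ^ (M - 1)) powr ?e"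
    using assms by (intro powr_mono2) auto
  also have "\<dots> = q powr ?e * (y ^ (M - 1)) powr ?e"
    using assms by (simp add: powr_mult)
  also have "(y ^ (M - 1)) powr ?e = y"
    using y M by (simp only: powr_powr powr_one flip: powr_realpow)
  finally show ?thesis .
qed

text \<open>With k = 2^m this places the threshold (3^m + 1)/2 below k(k - 1)/2, so that admissible
  sets exist. It fails at m = 1.\<close>

lemma three_power_le:
  assumes "2 \<le> m"
  shows "(3::real) ^ m + 1 \<le> 2 ^ m * (2 ^ m - 1)"
  using assms
proof (induction m rule: dec_induct)
  case (step m)
  define x :: real where "x = 2 ^ m"
  have "(3::real) ^ m + 1 + x \<le> x * x"
    using step.IH by (simp add: x_def algebra_simps)
  moreover have "x > 0" by (simp add: x_def)
  ultimately have "3 * 3 ^ m + 1 + 2 * x \<le> 4 * (x * x)"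
    using zero_le_square[of x] by linarith
  then show ?case by (simp add: x_def algebra_simps)
qed simp

theorem theorem1p6:
  fixes k :: nat
  assumes "k \<ge> 8" and "\<exists>m::nat. k = 2 ^ m"
  shows "(\<lambda>n::nat. real (g n k ((real k powr log 2 3 + 1) / 2)))
           \<in> \<Omega>[at_top](\<lambda>n. real n powr (1 + 2 / (real k - 2)))"
proof -
  obtain m' where m': "k = 2 ^ m'" using assms by blast
  have "m' \<ge> 3"
  proof (rule ccontr)
    assume "\<not> ?thesis"
    then have "(2::nat) ^ m' \<le> 2 ^ 2" by (intro power_increasing) auto
    then show False using m' assms by simp
  qed
  then obtain m where m: "m' = Suc m" "m \<ge> 2" by (cases m') auto
  have "real k powr log 2 3 = (2 powr real m') powr log 2 3"
    by (simp add: m' powr_realpow)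
  also have "\<dots> = (2 powr log 2 3) powr real m'"
    by (simp only: powr_powr mult.commute)
  also have "\<dots> = 3 ^ m'"
    by (simp add: powr_realpow)
  finally have l: "real k powr log 2 3 = 3 ^ Suc m" using m by simp
  \<comment> \<open>\<open>?q\<close> is both the constant in the power bound and the threshold for
    n. With 2^m = k/2, the exponent \<open>?e\<close> is 2/(k - 2), and \<open>?c\<close> undoes the
    factors \<open>?q powr ?e\<close> and 4.\<close>
  let ?l = "(3 ^ Suc m + 1) / 2 :: real" and ?q = "4 * 3 ^ m + 2 :: nat"
  let ?e = "1 / (real (2 ^ m) - 1)"
  let ?c = "1 / (4 * real ?q powr ?e)"
  have k: "k = 2 ^ Suc m" using m m' by simp
  have M: "(2::nat) ^ 2 \<le> 2 ^ m" using m by (intro power_increasing) auto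
  have q: "real ?q > 0" by (simp only: of_nat_0_less_iff)
  have e: "1 + 2 / (real k - 2) = 1 + ?e"
  proof -
    have "real k - 2 = 2 * (real (2 ^ m) - 1)" by (simp add: k)
    then show ?thesis using mult_divide_mult_cancel_left[of 2 1 "real (2 ^ m) - 1"] by simp
  qed
  have "?c * real n powr (1 + ?e) \<le> real (g n k ?l)" if n: "n \<ge> ?q" for n
  proof -
    have "?l \<le> real k * (real k - 1) / 2"
      using three_power_le[of "Suc m"] m by (simp add: k)
    then have "\<exists>A. locally_diverse n k ?l A"
      using assms(1) by (intro locally_diverse_exists) auto
    then obtain A where A: "locally_diverse n k ?l A" "g n k ?l = card (pos_diff_set A)"
      by (rule g_attained)
    have "n ^ 2 ^ m < ?q * (4 * g n k ?l) ^ (2 ^ m - 1)"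
      using locally_diverse_card_bound[of n m A] A n k by simp
    then have "real (n ^ 2 ^ m) < real (?q * (4 * g n k ?l) ^ (2 ^ m - 1))"
      by (simp only: of_nat_less_iff)
    then have "real n ^ 2 ^ m < real ?q * (4 * real (g n k ?l)) ^ (2 ^ m - 1)"
      by (simp only: of_nat_mult of_nat_power of_nat_numeral)
    then have "real n powr (1 + ?e) \<le> real ?q powr ?e * (4 * real (g n k ?l))"
      by (rule powr_le_of_power_less) (use n M q in \<open>auto simp del: of_nat_add\<close>)
    moreover have "real ?q powr ?e > 0" using q by (simp only: powr_gt_zero)
    ultimately show ?thesis by (simp add: field_simps)
  qed
  then have "eventually (\<lambda>n. ?c * real n powr (1 + ?e) \<le> real (g n k ?l)) at_top"
    by (rule eventually_sequentiallyI)
  moreover have "?c > 0" using q by (simp del: of_nat_add)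
  ultimately show ?thesis
    unfolding l e by (intro landau_omega.bigI[where c = ?c]) simp_all
qed

end
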